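(* Let $\Gamma$ be a finitely generated discrete group of isometries of a symmetric space, and let $\Sigma$ and $\Sigma'$ be two finite sets of generators of $\Gamma$, with induced word distance functions $d_\Sigma$ and $d_{\Sigma'}$. Then $d_\Sigma$ and $d_{\Sigma'}$ are Lipschitz equivalent.
   Context: A symmetric space $(X,d)$ is a differentiable manifold $X$ which is a metric space with a Riemannian distance function $d$, such that some group $G$ acts transitively and by isometries on $X$, and there are a point $0\in X$ and an element $k\in G$ with $k\cdot 0=0$ and differential $Dk(0)=-I$. A discrete group of isometries of $X$ is a subgroup of the isometry group of $X$ that is discrete in the compact-open topology. For a finite generating set $\Sigma$ of $\Gamma$, the word distance $d_\Sigma(\gamma_1,\gamma_2)$ is the smallest integer $n\ge0$ such that $\gamma_1^{-1}\gamma_2$ is a product of $n$ elements of $\Sigma\cup\Sigma^{-1}$. Two distance functions $\delta,\delta'$ on $\Gamma$ are Lipschitz equivalent if there are constants $c,C>0$ such that $c\,\delta(\gamma_1,\gamma_2)\le\delta'(\gamma_1,\gamma_2)\le C\,\delta(\gamma_1,\gamma_2)$ for all $\gamma_1,\gamma_2\in\Gamma$. *)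

theory Defs
  imports "HOL-Algebra.Generated_Groups" "HOL-Algebra.Group_Action" "HOL-Analysis.Analysis"
begin

section \<open>Smooth maps between open sets of normed spaces\<close>

text \<open>The following is meant for open \<open>S\<close> in a finite-dimensional space. There, continuity of all
  iterated directional derivatives is the same as continuity of the iterated Frechet derivatives.\<close>

primrec Ck_on :: "nat \<Rightarrow> ('v::real_normed_vector) set \<Rightarrow> ('v \<Rightarrow> 'w::real_normed_vector) \<Rightarrow> bool"
  where
    "Ck_on 0 S f \<longleftrightarrow> continuous_on S f"
  | "Ck_on (Suc k) S f \<longleftrightarrow>
       (\<forall>x\<in>S. f differentiable (at x)) \<and> (\<forall>v. Ck_on k S (\<lambda>x. frechet_derivative f (at x) v))"

definition smooth_on :: "('v::real_normed_vector) set \<Rightarrow> ('v \<Rightarrow> 'w::real_normed_vector) \<Rightarrow> bool"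
  where "smooth_on S f \<longleftrightarrow> (\<forall>k. Ck_on k S f)"

section \<open>Smooth manifolds\<close>

text \<open>A chart is a pair of a domain \<open>U\<close> and a coordinate map, whose values outside \<open>U\<close> are irrelevant.\<close>

type_synonym ('a, 'v) chart = "'a set \<times> ('a \<Rightarrow> 'v)"

definition chart_of :: "'a topology \<Rightarrow> ('a, 'v::real_normed_vector) chart \<Rightarrow> bool"
  where "chart_of T = (\<lambda>(U, \<phi>). openin T U \<and> open (\<phi> ` U) \<and>
           homeomorphic_map (subtopology T U) (top_of_set (\<phi> ` U)) \<phi>)"

definition transition :: "('a, 'v) chart \<Rightarrow> ('a, 'v) chart \<Rightarrow> 'v \<Rightarrow> 'v"
  where "transition = (\<lambda>(U, \<phi>) (V, \<psi>). \<psi> \<circ> inv_into U \<phi>)"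

text \<open>The model space is finite-dimensional, but it may be zero-dimensional, which is why the class
  is not \<open>euclidean_space\<close>.\<close>

definition smooth_atlas :: "'a topology \<Rightarrow> ('a, 'v::real_normed_vector) chart set \<Rightarrow> bool"
  where "smooth_atlas T A \<longleftrightarrow>
           (\<exists>B::'v set. finite B \<and> span B = UNIV) \<and>
           (\<forall>c\<in>A. chart_of T c) \<and>
           (\<Union>c\<in>A. fst c) = topspace T \<and>
           (\<forall>c\<in>A. \<forall>c'\<in>A. smooth_on (snd c ` (fst c \<inter> fst c')) (transition c c'))"

section \<open>Riemannian metrics and their distance functions\<close>

text \<open>A Riemannian metric is given by its local expressions: \<open>g c p\<close> is the inner product on the
  tangent space at \<open>p\<close>, written in the coordinates of the chart \<open>c\<close>. The last condition is the
  transformation rule of a covariant 2-tensor under a change of coordinates.\<close>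

definition riemannian_metric ::
    "('a, 'v::real_normed_vector) chart set \<Rightarrow>
     (('a, 'v) chart \<Rightarrow> 'a \<Rightarrow> 'v \<Rightarrow> 'v \<Rightarrow> real) \<Rightarrow> bool"
  where "riemannian_metric A g \<longleftrightarrow>
     (\<forall>c\<in>A. \<forall>p\<in>fst c. bilinear (g c p) \<and> (\<forall>u v. g c p u v = g c p v u) \<and>
        (\<forall>v. v \<noteq> 0 \<longrightarrow> 0 < g c p v v)) \<and>
     (\<forall>c\<in>A. \<forall>u v. smooth_on (snd c ` fst c) (\<lambda>x. g c (inv_into (fst c) (snd c) x) u v)) \<and>
     (\<forall>c\<in>A. \<forall>c'\<in>A. \<forall>p\<in>fst c \<inter> fst c'. \<forall>u v.
        g c p u v = g c' p (frechet_derivative (transition c c') (at (snd c p)) u)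
                           (frechet_derivative (transition c c') (at (snd c p)) v))"

definition C1_curve_on :: "('a, 'v::real_normed_vector) chart set \<Rightarrow> real \<Rightarrow> real \<Rightarrow> (real \<Rightarrow> 'a) \<Rightarrow> bool"
  where "C1_curve_on A a b \<gamma> \<longleftrightarrow>
     (\<forall>(U, \<phi>)\<in>A. \<exists>D. continuous_on {t\<in>{a..b}. \<gamma> t \<in> U} D \<and>
        (\<forall>t\<in>{a..b}. \<gamma> t \<in> U \<longrightarrow> ((\<phi> \<circ> \<gamma>) has_vector_derivative D t) (at t within {a..b})))"

text \<open>\<open>S\<close> is the set of break points: the curve is \<open>C\<^sup>1\<close>, up to and including the
  end points, on every closed interval whose interior avoids \<open>S\<close>.\<close>

definition piecewise_C1_curves ::
    "'a topology \<Rightarrow> ('a, 'v::real_normed_vector) chart set \<Rightarrow> 'a \<Rightarrow> 'a \<Rightarrow> (real \<Rightarrow> 'a) set"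
  where "piecewise_C1_curves T A p q =
     {\<gamma>. pathin T \<gamma> \<and> \<gamma> 0 = p \<and> \<gamma> 1 = q \<and>
        (\<exists>S. finite S \<and>
           (\<forall>a b. 0 \<le> a \<and> a < b \<and> b \<le> 1 \<and> {a<..<b} \<inter> S = {} \<longrightarrow> C1_curve_on A a b \<gamma>))}"

text \<open>The speed does not depend on the chart that is chosen. At the finitely many break points and end
  points its value is irrelevant for the length.\<close>

definition speed ::
    "('a, 'v::real_normed_vector) chart set \<Rightarrow> (('a, 'v) chart \<Rightarrow> 'a \<Rightarrow> 'v \<Rightarrow> 'v \<Rightarrow> real) \<Rightarrow>
     (real \<Rightarrow> 'a) \<Rightarrow> real \<Rightarrow> real"
  where "speed A g \<gamma> t =
     (let c = (SOME c. c \<in> A \<and> \<gamma> t \<in> fst c);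
          v = vector_derivative (snd c \<circ> \<gamma>) (at t)
      in sqrt (g c (\<gamma> t) v v))"

definition curve_length ::
    "('a, 'v::real_normed_vector) chart set \<Rightarrow> (('a, 'v) chart \<Rightarrow> 'a \<Rightarrow> 'v \<Rightarrow> 'v \<Rightarrow> real) \<Rightarrow>
     (real \<Rightarrow> 'a) \<Rightarrow> real"
  where "curve_length A g \<gamma> = integral {0..1} (speed A g \<gamma>)"

text \<open>The infimum is taken in the extended reals, where the infimum of the empty set is \<open>\<infinity>\<close>.
  Hence any two points are joined by a curve, and the manifold is connected.\<close>

locale riemannian_space = Metric_space X d
  for X :: "'a set" and d :: "'a \<Rightarrow> 'a \<Rightarrow> real" +
  fixes A :: "('a, 'v::real_normed_vector) chart set"
    and g :: "('a, 'v) chart \<Rightarrow> 'a \<Rightarrow> 'v \<Rightarrow> 'v \<Rightarrow> real"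
  assumes smooth_atlas: "smooth_atlas mtopology A"
    and riemannian_metric: "riemannian_metric A g"
    and riemannian_distance:
      "\<And>p q. p \<in> X \<Longrightarrow> q \<in> X \<Longrightarrow>
        ereal (d p q) = (INF \<gamma>\<in>piecewise_C1_curves mtopology A p q. ereal (curve_length A g \<gamma>))"

section \<open>Symmetric spaces and discrete groups of isometries\<close>

locale symmetric_space = riemannian_space X d A g + transitive_action G X act
  for X :: "'a set" and d :: "'a \<Rightarrow> 'a \<Rightarrow> real"
    and A :: "('a, 'v::real_normed_vector) chart set"
    and g :: "('a, 'v) chart \<Rightarrow> 'a \<Rightarrow> 'v \<Rightarrow> 'v \<Rightarrow> real"
    and G :: "('g, 'm) monoid_scheme" (structure) and act :: "'g \<Rightarrow> 'a \<Rightarrow> 'a" +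
  assumes isometric_action:
      "\<And>h x y. h \<in> carrier G \<Longrightarrow> x \<in> X \<Longrightarrow> y \<in> X \<Longrightarrow> d (act h x) (act h y) = d x y"
    and symmetry:
      "\<exists>p\<in>X. \<exists>k\<in>carrier G. act k p = p \<and>
         (\<forall>(U, \<phi>)\<in>A. p \<in> U \<longrightarrow>
            ((\<phi> \<circ> act k \<circ> inv_into U \<phi>) has_derivative (\<lambda>v. - v)) (at (\<phi> p)))"

definition isometry_group :: "'a set \<Rightarrow> ('a \<Rightarrow> 'a \<Rightarrow> real) \<Rightarrow> ('a \<Rightarrow> 'a) monoid"
  where "isometry_group X d =
     (BijGroup X)\<lparr>carrier := {f \<in> Bij X. \<forall>x\<in>X. \<forall>y\<in>X. d (f x) (f y) = d x y}\<rparr>"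

definition compact_open_topology :: "'a topology \<Rightarrow> 'b topology \<Rightarrow> ('a \<Rightarrow> 'b) set \<Rightarrow> ('a \<Rightarrow> 'b) topology"
  where "compact_open_topology S T F =
     topology_generated_by {{f \<in> F. f ` K \<subseteq> U} | K U. compactin S K \<and> openin T U}"

definition discrete_isometry_group :: "'a set \<Rightarrow> ('a \<Rightarrow> 'a \<Rightarrow> real) \<Rightarrow> ('a \<Rightarrow> 'a) set \<Rightarrow> bool"
  where "discrete_isometry_group X d \<Gamma> \<longleftrightarrow>
     subgroup \<Gamma> (isometry_group X d) \<and>
     subtopology
       (compact_open_topology (Metric_space.mtopology X d) (Metric_space.mtopology X d)
          (carrier (isometry_group X d))) \<Gamma>
     = discrete_topology \<Gamma>"

section \<open>Word distances\<close>

definition finite_generating_set :: "('g, 'm) monoid_scheme \<Rightarrow> 'g set \<Rightarrow> 'g set \<Rightarrow> bool"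
  where "finite_generating_set G \<Gamma> \<Sigma> \<longleftrightarrow> finite \<Sigma> \<and> \<Sigma> \<subseteq> \<Gamma> \<and> generate G \<Sigma> = \<Gamma>"

definition word_distance :: "('g, 'm) monoid_scheme \<Rightarrow> 'g set \<Rightarrow> 'g \<Rightarrow> 'g \<Rightarrow> nat"
  where "word_distance G \<Sigma> x y =
     (LEAST n. \<exists>ws. length ws = n \<and> set ws \<subseteq> \<Sigma> \<union> set_inv\<^bsub>G\<^esub> \<Sigma> \<and>
        inv\<^bsub>G\<^esub> x \<otimes>\<^bsub>G\<^esub> y = foldr (\<otimes>\<^bsub>G\<^esub>) ws \<one>\<^bsub>G\<^esub>)"

definition lipschitz_equivalent :: "'b set \<Rightarrow> ('b \<Rightarrow> 'b \<Rightarrow> real) \<Rightarrow> ('b \<Rightarrow> 'b \<Rightarrow> real) \<Rightarrow> bool"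
  where "lipschitz_equivalent \<Gamma> \<delta> \<delta>' \<longleftrightarrow>
     (\<exists>c C. 0 < c \<and> 0 < C \<and>
        (\<forall>x\<in>\<Gamma>. \<forall>y\<in>\<Gamma>. c * \<delta> x y \<le> \<delta>' x y \<and> \<delta>' x y \<le> C * \<delta> x y))"

end

theory Submission
  imports Defs
begin

text \<open>Every element of \<open>\<Sigma>\<close> or \<open>\<Sigma>\<inverse>\<close> is a word in \<open>\<Sigma>'\<close>, and by finiteness these words have length
  at most some \<open>N\<close>. Substituting them letter by letter turns a word of length \<open>n\<close> in \<open>\<Sigma>\<close> into a
  word of length at most \<open>N n\<close> in \<open>\<Sigma>'\<close>. Exchanging the two sets gives the other inequality.\<close>

lemma subgroup_isometries_BijGroup:
  "subgroup {f \<in> Bij X. \<forall>x\<in>X. \<forall>y\<in>X. d (f x) (f y) = d x y} (BijGroup X)"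
  (is "subgroup ?I _")
proof (rule group.subgroupI[OF group_BijGroup])
  show "?I \<subseteq> carrier (BijGroup X)"
    by (auto simp: BijGroup_def)
  have "(\<lambda>x\<in>X. x) \<in> ?I"
    using id_Bij by auto
  then show "?I \<noteq> {}"
    by blast
next
  fix f assume f: "f \<in> ?I"
  then have bij: "bij_betw f X X"
    by (simp add: Bij_def)
  have "d (inv_into X f x) (inv_into X f y) = d x y" if "x \<in> X" "y \<in> X" for x y
  proof -
    \<comment> \<open>The isometry equation for \<open>f\<close> is applied at the preimages of
      \<open>x\<close> and \<open>y\<close>; surjectivity then turns it into the equation for the
      inverse.\<close>
    have "d (f (inv_into X f x)) (f (inv_into X f y)) = d (inv_into X f x) (inv_into X f y)"
      using f bij that by (auto simp: bij_betw_def inv_into_into)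
    then show ?thesis
      using bij that by (simp add: bij_betw_inv_into_right)
  qed
  then show "inv\<^bsub>BijGroup X\<^esub> f \<in> ?I"
    using f by (simp add: inv_BijGroup restrict_inv_into_Bij)
next
  fix f h assume "f \<in> ?I" "h \<in> ?I"
  then show "f \<otimes>\<^bsub>BijGroup X\<^esub> h \<in> ?I"
    by (auto simp: BijGroup_def compose_Bij compose_eq funcset_mem[OF Bij_imp_funcset])
qed

text \<open>\<open>isometry_group X d\<close> is \<open>BijGroup X\<close> with its carrier cut down
  to a subgroup, so it inherits the group axioms.\<close>

lemma group_isometry_group: "group (isometry_group X d)"
  unfolding isometry_group_def
  by (rule subgroup.subgroup_is_group[OF subgroup_isometries_BijGroup group_BijGroup])

context group
begin

lemma set_inv_closed: "S \<subseteq> carrier G \<Longrightarrow> set_inv S \<subseteq> carrier G"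
  by (auto simp: SET_INV_def)

lemma foldr_mult_closed:
  "set ws \<subseteq> carrier G \<Longrightarrow> foldr (\<otimes>) ws \<one> \<in> carrier G"
  by (induction ws) auto

lemma foldr_mult_append:
  assumes "set vs \<subseteq> carrier G" "set ws \<subseteq> carrier G"
  shows "foldr (\<otimes>) (vs @ ws) \<one> = foldr (\<otimes>) vs \<one> \<otimes> foldr (\<otimes>) ws \<one>"
  using assms by (induction vs) (auto simp: m_assoc foldr_mult_closed)

text \<open>The rules of \<open>generate\<close> invert single generators only, so words never have
  to be reversed: each generator or its inverse is a one-letter word, and products are
  concatenations.\<close>

lemma generate_imp_word:
  assumes "x \<in> generate G S" and "S \<subseteq> carrier G"
  shows "\<exists>ws. set ws \<subseteq> S \<union> set_inv S \<and> x = foldr (\<otimes>) ws \<one>"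
  using assms(1)
proof induction
  case one
  show ?case
    by (rule exI[of _ "[]"]) simp
next
  case (incl s)
  then show ?case
    using assms(2) by (intro exI[of _ "[s]"]) auto
next
  case (inv s)
  then show ?case
    using assms(2) by (intro exI[of _ "[inv s]"]) (auto simp: SET_INV_def)
next
  case (eng x y)
  then obtain vs ws where
    "set vs \<subseteq> S \<union> set_inv S" "x = foldr (\<otimes>) vs \<one>"
    "set ws \<subseteq> S \<union> set_inv S" "y = foldr (\<otimes>) ws \<one>"
    by blast
  moreover from this have "foldr (\<otimes>) (vs @ ws) \<one> = x \<otimes> y"
    using foldr_mult_append[of vs ws] assms(2) set_inv_closed by blast
  ultimately show ?case
    by (intro exI[of _ "vs @ ws"]) simp
qed

lemma finite_words_bounded:
  assumes "finite S" and "S \<subseteq> generate G T" and "T \<subseteq> carrier G"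
  shows "\<exists>N>0. \<forall>s\<in>S. \<exists>ws. length ws \<le> N \<and> set ws \<subseteq> T \<union> set_inv T \<and> s = foldr (\<otimes>) ws \<one>"
proof -
  have "\<forall>s\<in>S. \<exists>ws. set ws \<subseteq> T \<union> set_inv T \<and> s = foldr (\<otimes>) ws \<one>"
    using assms generate_imp_word by blast
  then obtain w where
    w: "\<forall>s\<in>S. set (w s) \<subseteq> T \<union> set_inv T \<and> s = foldr (\<otimes>) (w s) \<one>"
    by metis
  \<comment> \<open>The sum of all the lengths serves as a common bound, which also covers an empty
    \<open>S\<close>. The \<open>Suc\<close> keeps it positive when every chosen word is
    empty.\<close>
  have "length (w s) \<le> Suc (\<Sum>s\<in>S. length (w s))" if "s \<in> S" for s
    using member_le_sum[OF that, of "\<lambda>s. length (w s)"] \<open>finite S\<close> by simp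
  then show ?thesis
    using w by (metis zero_less_Suc)
qed

text \<open>Each letter is replaced by a word of length at most \<open>N\<close>, and the results
  are concatenated. The alphabet \<open>S\<close> is arbitrary, so it may already contain the
  inverses of generators.\<close>

lemma word_substitution:
  assumes T: "T \<subseteq> carrier G"
    and letters: "\<And>s. s \<in> S \<Longrightarrow>
      \<exists>ws. length ws \<le> N \<and> set ws \<subseteq> T \<union> set_inv T \<and> s = foldr (\<otimes>) ws \<one>"
    and "set vs \<subseteq> S"
  shows "\<exists>ws. length ws \<le> N * length vs \<and> set ws \<subseteq> T \<union> set_inv T \<and>
           foldr (\<otimes>) vs \<one> = foldr (\<otimes>) ws \<one>"
  using \<open>set vs \<subseteq> S\<close>
proof (induction vs)
  case Nil
  show ?case
    by (rule exI[of _ "[]"]) simp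
next
  case (Cons s vs)
  then obtain us ws where
    us: "length us \<le> N" "set us \<subseteq> T \<union> set_inv T" "s = foldr (\<otimes>) us \<one>" and
    ws: "length ws \<le> N * length vs" "set ws \<subseteq> T \<union> set_inv T"
        "foldr (\<otimes>) vs \<one> = foldr (\<otimes>) ws \<one>"
    using letters[of s] by auto
  then have "foldr (\<otimes>) (us @ ws) \<one> = s \<otimes> foldr (\<otimes>) vs \<one>"
    using foldr_mult_append[of us ws] T set_inv_closed by (metis Un_least subset_trans)
  then show ?case
    using us ws by (intro exI[of _ "us @ ws"]) simp
qed

text \<open>This is one half of the equivalence; the other half follows by exchanging
  \<open>S\<close> and \<open>T\<close>.\<close>

lemma word_distance_le_mult:
  assumes "subgroup \<Gamma> G" and "finite_generating_set G \<Gamma> S" and "finite_generating_set G \<Gamma> T"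
  shows "\<exists>N>0. \<forall>x\<in>\<Gamma>. \<forall>y\<in>\<Gamma>. word_distance G T x y \<le> N * word_distance G S x y"
proof -
  have S: "finite S" "S \<subseteq> \<Gamma>" "generate G S = \<Gamma>" and T: "T \<subseteq> \<Gamma>" "generate G T = \<Gamma>"
    using assms(2,3) by (auto simp: finite_generating_set_def)
  have carrier: "S \<subseteq> carrier G" "T \<subseteq> carrier G"
    using S T subgroup.subset[OF assms(1)] by auto
  \<comment> \<open>The alphabet of words over \<open>S\<close> includes inverses, and these lie in
    \<open>generate G T\<close> because \<Gamma> is a subgroup.\<close>
  have "finite (S \<union> set_inv S)" "S \<union> set_inv S \<subseteq> generate G T"
    using S T subgroup.m_inv_closed[OF assms(1)] by (auto simp: SET_INV_def)
  then obtain N where "N > 0" and N: "\<And>s. s \<in> S \<union> set_inv S \<Longrightarrow>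
      \<exists>ws. length ws \<le> N \<and> set ws \<subseteq> T \<union> set_inv T \<and> s = foldr (\<otimes>) ws \<one>"
    using finite_words_bounded[OF _ _ carrier(2)] by metis
  have "word_distance G T x y \<le> N * word_distance G S x y" if "x \<in> \<Gamma>" "y \<in> \<Gamma>" for x y
  proof -
    have "inv x \<otimes> y \<in> generate G S"
      using that S(3) assms(1) by (simp add: subgroup.m_closed subgroup.m_inv_closed)
    \<comment> \<open>Since \<open>S\<close> generates \<Gamma>, the minimum in
      \<open>word_distance\<close> is taken over a nonempty set. It is therefore attained, by a
      shortest word \<open>vs\<close>.\<close>
    then have "\<exists>n ws. length ws = n \<and> set ws \<subseteq> S \<union> set_inv S \<and> inv x \<otimes> y = foldr (\<otimes>) ws \<one>"
      using generate_imp_word carrier(1) by blast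
    from LeastI_ex[OF this] obtain vs where vs: "length vs = word_distance G S x y"
        "set vs \<subseteq> S \<union> set_inv S" "inv x \<otimes> y = foldr (\<otimes>) vs \<one>"
      unfolding word_distance_def by blast
    obtain ws where ws: "length ws \<le> N * length vs" "set ws \<subseteq> T \<union> set_inv T"
        "foldr (\<otimes>) vs \<one> = foldr (\<otimes>) ws \<one>"
      using word_substitution[OF carrier(2) N vs(2)] by blast
    \<comment> \<open>The word \<open>ws\<close> need not be shortest: any word over
      \<open>T\<close> for the same element bounds the distance from above.\<close>
    have "word_distance G T x y \<le> length ws"
      unfolding word_distance_def using ws vs(3) by (intro Least_le exI[of _ ws]) simp
    then show ?thesis
      using ws(1) vs(1) by simp
  qed
  then show ?thesis
    using \<open>N > 0\<close> by blast
qed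

lemma lipschitz_equivalent_word_distance:
  assumes "subgroup \<Gamma> G" and "finite_generating_set G \<Gamma> S" and "finite_generating_set G \<Gamma> T"
  shows "lipschitz_equivalent \<Gamma> (\<lambda>x y. real (word_distance G S x y))
           (\<lambda>x y. real (word_distance G T x y))"
proof -
  obtain M where M: "M > 0"
      "\<forall>x\<in>\<Gamma>. \<forall>y\<in>\<Gamma>. word_distance G S x y \<le> M * word_distance G T x y"
    using word_distance_le_mult[OF assms(1,3,2)] by blast
  obtain N where N: "N > 0"
      "\<forall>x\<in>\<Gamma>. \<forall>y\<in>\<Gamma>. word_distance G T x y \<le> N * word_distance G S x y"
    using word_distance_le_mult[OF assms] by blast
  \<comment> \<open>The factor \<open>M\<close> for the exchanged sets becomes the lower constant
    \<open>1 / M\<close>, so its positivity matters here.\<close>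
  have "1 / real M * real (word_distance G S x y) \<le> real (word_distance G T x y) \<and>
        real (word_distance G T x y) \<le> real N * real (word_distance G S x y)"
    if "x \<in> \<Gamma>" "y \<in> \<Gamma>" for x y
  proof -
    have "real (word_distance G S x y) \<le> real M * real (word_distance G T x y)"
      "real (word_distance G T x y) \<le> real N * real (word_distance G S x y)"
      using M(2) N(2) that by (metis of_nat_le_iff of_nat_mult)+
    then show ?thesis
      using M(1) by (simp add: field_simps)
  qed
  then show ?thesis
    unfolding lipschitz_equivalent_def using M(1) N(1)
    by (intro exI[of _ "1 / real M"] exI[of _ "real N"]) simp
qed

end

theorem lemma3p3p2:
  fixes X :: "'a set" and d :: "'a \<Rightarrow> 'a \<Rightarrow> real"
    and A :: "('a, 'v::real_normed_vector) chart set"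
    and g :: "('a, 'v) chart \<Rightarrow> 'a \<Rightarrow> 'v \<Rightarrow> 'v \<Rightarrow> real"
    and G :: "('g, 'm) monoid_scheme" and act :: "'g \<Rightarrow> 'a \<Rightarrow> 'a"
    and \<Gamma> \<Sigma> \<Sigma>' :: "('a \<Rightarrow> 'a) set"
  assumes "symmetric_space X d A g G act"
    and "discrete_isometry_group X d \<Gamma>"
    and "finite_generating_set (isometry_group X d) \<Gamma> \<Sigma>"
    and "finite_generating_set (isometry_group X d) \<Gamma> \<Sigma>'"
  shows "lipschitz_equivalent \<Gamma>
           (\<lambda>x y. real (word_distance (isometry_group X d) \<Sigma> x y))
           (\<lambda>x y. real (word_distance (isometry_group X d) \<Sigma>' x y))"
proof -
  interpret group "isometry_group X d"
    by (rule group_isometry_group)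
  show ?thesis
    \<comment> \<open>Unfolding \<open>discrete_isometry_group\<close> supplies the fact that
      \<Gamma> is a subgroup of the isometry group.\<close>
    using assms(2-4) lipschitz_equivalent_word_distance
    by (simp add: discrete_isometry_group_def)
qed

end
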